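(* Let $\mathcal{V}$ be a subspace of $\mathcal{H}_2(\mathbb{D})$ of dimension $n$ with orthonormal basis $(V_1,\ldots,V_n)$. Let $\ell_1,\ldots,\ell_m$ be linearly independent continuous linear functionals on $\mathcal{H}_2(\mathbb{D})$, where $n\le m$, with Riesz representers $L_1,\ldots,L_m\in\mathcal{H}_2(\mathbb{D})$, i.e. $\ell_k(F)=\langle F,L_k\rangle_{\mathcal{H}_2}$ for all $F\in\mathcal{H}_2(\mathbb{D})$, and let $\mathcal{L}:\mathcal{H}_2(\mathbb{D})\to\mathbb{C}^m$, $\mathcal{L}(F)=(\ell_1(F),\ldots,\ell_m(F))$. Let $G\in\mathbb{C}^{m\times n}$ and $H\in\mathbb{C}^{m\times m}$ be the matrices with entries $$G_{k,j}=\ell_k(V_j)\quad (1\le k\le m,\ 1\le j\le n),\qquad H_{k,j}=\ell_k(L_j)\quad (1\le k,j\le m).$$ Then $$\mu_{\mathcal{H}_2}(\ker(\mathcal{L}),\mathcal{V})=\frac{1}{\lambda_{\min}(G^*H^{-1}G)^{1/2}}.$$ Moreover, assume that $G^*H^{-1}G$ is invertible and, for $y\in\mathbb{C}^m$, put $c^\star=(G^*H^{-1}G)^{-1}G^*H^{-1}y\in\mathbb{C}^n$ and $d^\star=H^{-1}(y-Gc^\star)\in\mathbb{C}^m$. Then the map $A^{\rm opt}:\mathbb{C}^m\to\mathcal{H}_2(\mathbb{D})$ defined by $$A^{\rm opt}(y)=\sum_{j=1}^n c_j^\star V_j+\sum_{k=1}^m d_k^\star L_k$$ is an optimal algorithm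 in the sense that, for every $\varepsilon>0$, $$\sup_{F\in\mathcal{K}_{\mathcal{H}_2}(\varepsilon,\mathcal{V})}\|F-A^{\rm opt}(\mathcal{L}(F))\|_{\mathcal{H}_2}=\inf_{A:\mathbb{C}^m\to\mathcal{H}_2(\mathbb{D})}\ \sup_{F\in\mathcal{K}_{\mathcal{H}_2}(\varepsilon,\mathcal{V})}\|F-A(\mathcal{L}(F))\|_{\mathcal{H}_2},$$ the infimum being over all maps $A$ (not necessarily linear), and the common value is $\mu_{\mathcal{H}_2}(\ker(\mathcal{L}),\mathcal{V})\,\varepsilon$.
   Context: $\mathbb{D}$ is the open unit disk in $\mathbb{C}$. $\mathcal{H}_2(\mathbb{D})$ is the Hardy Hilbert space of functions $F(z)=\sum_{n\ge0}f_nz^n$ analytic on $\mathbb{D}$ with $\|F\|_{\mathcal{H}_2}=(\sum_{n\ge 0}|f_n|^2)^{1/2}<\infty$; its inner product is linear in the first argument. For a subspace $\mathcal{V}$ and $\varepsilon>0$, $$\mathcal{K}_{\mathcal{H}_2}(\varepsilon,\mathcal{V})=\{F\in\mathcal{H}_2(\mathbb{D}):\mathrm{dist}_{\mathcal{H}_2}(F,\mathcal{V})\le\varepsilon\},\qquad \mu_{\mathcal{H}_2}(\ker(\mathcal{L}),\mathcal{V})=\sup_{F\in\ker(\mathcal{L}),\,F\ne0}\frac{\|F\|_{\mathcal{H}_2}}{\mathrm{dist}_{\mathcal{H}_2}(F,\mathcal{V})}\in[1,+\infty],$$ where $\mathrm{dist}_{\mathcal{H}_2}(F,\mathcal{V})=\inf_{V\in\mathcal{V}}\|F-V\|_{\mathcal{H}_2}$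 and a ratio with positive numerator and zero denominator is $+\infty$ (likewise $1/0=+\infty$). $\lambda_{\min}$ is the smallest eigenvalue of a Hermitian positive semidefinite matrix, and $G^*$ is the conjugate transpose of $G$. *)

theory Defs
  imports "HOL-Complex_Analysis.Complex_Analysis"
begin

section \<open>The Hardy space\<close>

definition taylor_coeff :: "(complex \<Rightarrow> complex) \<Rightarrow> nat \<Rightarrow> complex" where
  "taylor_coeff f n = (deriv ^^ n) f 0 / fact n"

definition hardy2_on_disk :: "(complex \<Rightarrow> complex) \<Rightarrow> bool" where
  "hardy2_on_disk f \<longleftrightarrow>
     f holomorphic_on ball 0 1 \<and> summable (\<lambda>n. (cmod (taylor_coeff f n))\<^sup>2)"

text \<open>
  HOL functions are total, so an analytic function on the disk is represented by its extension by
  zero; equality in the type below is then equality of functions on the disk.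
\<close>

typedef hardy2 =
  "{f :: complex \<Rightarrow> complex. hardy2_on_disk f \<and> (\<forall>z. z \<notin> ball 0 1 \<longrightarrow> f z = 0)}"
  morphisms h2_eval Abs_hardy2
proof (intro exI CollectI conjI)
  have "taylor_coeff (\<lambda>_. 0) n = 0" for n
    by (simp add: taylor_coeff_def)
  then show "hardy2_on_disk (\<lambda>_. 0)"
    by (simp add: hardy2_on_disk_def)
qed simp

setup_lifting type_definition_hardy2

definition h2_coeff :: "hardy2 \<Rightarrow> nat \<Rightarrow> complex" where
  "h2_coeff F n = taylor_coeff (h2_eval F) n"

lemma h2_holomorphic: "h2_eval F holomorphic_on ball 0 1"
  using h2_eval[of F] by (simp add: hardy2_on_disk_def)

lemma h2_eval_outside: "z \<notin> ball 0 1 \<Longrightarrow> h2_eval F z = 0"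
  using h2_eval[of F] by simp

lemma h2_summable: "summable (\<lambda>n. (cmod (h2_coeff F n))\<^sup>2)"
  using h2_eval[of F] by (simp add: h2_coeff_def hardy2_on_disk_def)

lemma h2_eqI: "(\<And>z. h2_eval F z = h2_eval G z) \<Longrightarrow> F = G"
  by (metis ext h2_eval_inject)

lemma h2_sums:
  assumes "z \<in> ball 0 1"
  shows "(\<lambda>n. h2_coeff F n * z ^ n) sums h2_eval F z"
  using holomorphic_power_series[OF h2_holomorphic assms, of F]
  by (simp add: h2_coeff_def taylor_coeff_def)

lemma h2_coeff_eqI:
  assumes "\<And>n. h2_coeff F n = h2_coeff G n"
  shows "F = G"
proof (rule h2_eqI)
  fix z
  show "h2_eval F z = h2_eval G z"
  proof (cases "z \<in> ball 0 1")
    case True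
    then show ?thesis
      using h2_sums[OF True, of F] h2_sums[OF True, of G] assms by (simp add: sums_unique2)
  qed (simp add: h2_eval_outside)
qed

lemma taylor_coeff_add:
  assumes "f holomorphic_on ball 0 1" "g holomorphic_on ball 0 1"
  shows "taylor_coeff (\<lambda>z. f z + g z) n = taylor_coeff f n + taylor_coeff g n"
  using higher_deriv_add[OF assms open_ball, of 0 n]
  by (simp add: taylor_coeff_def add_divide_distrib)

lemma taylor_coeff_cmult:
  assumes "f holomorphic_on ball 0 1"
  shows "taylor_coeff (\<lambda>z. c * f z) n = c * taylor_coeff f n"
  using higher_deriv_cmult[OF assms _ open_ball, of 0 n c]
  by (simp add: taylor_coeff_def)

lemma cmod_add_squared_le: "(cmod (a + b))\<^sup>2 \<le> 2 * (cmod a)\<^sup>2 + 2 * (cmod b)\<^sup>2"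
proof -
  have "(cmod (a + b))\<^sup>2 \<le> (cmod a + cmod b)\<^sup>2"
    by (intro power_mono norm_triangle_ineq) simp
  also have "\<dots> \<le> 2 * (cmod a)\<^sup>2 + 2 * (cmod b)\<^sup>2"
    using zero_le_power2[of "cmod a - cmod b"] by (simp add: power2_eq_square algebra_simps)
  finally show ?thesis .
qed

lemma hardy2_on_disk_add:
  assumes "hardy2_on_disk f" "hardy2_on_disk g"
  shows "hardy2_on_disk (\<lambda>z. f z + g z)"
  unfolding hardy2_on_disk_def
proof
  show "(\<lambda>z. f z + g z) holomorphic_on ball 0 1"
    using assms by (auto simp: hardy2_on_disk_def intro: holomorphic_intros)
  show "summable (\<lambda>n. (cmod (taylor_coeff (\<lambda>z. f z + g z) n))\<^sup>2)"
  proof (rule summable_comparison_test')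
    show "summable (\<lambda>n. 2 * (cmod (taylor_coeff f n))\<^sup>2 + 2 * (cmod (taylor_coeff g n))\<^sup>2)"
      using assms by (intro summable_add summable_mult) (simp_all add: hardy2_on_disk_def)
    fix n
    show "norm ((cmod (taylor_coeff (\<lambda>z. f z + g z) n))\<^sup>2)
        \<le> 2 * (cmod (taylor_coeff f n))\<^sup>2 + 2 * (cmod (taylor_coeff g n))\<^sup>2"
      using assms by (simp add: hardy2_on_disk_def taylor_coeff_add cmod_add_squared_le)
  qed
qed

lemma hardy2_on_disk_cmult:
  assumes "hardy2_on_disk f"
  shows "hardy2_on_disk (\<lambda>z. c * f z)"
  unfolding hardy2_on_disk_def
proof
  show "(\<lambda>z. c * f z) holomorphic_on ball 0 1"
    using assms by (auto simp: hardy2_on_disk_def intro: holomorphic_intros)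
  have "summable (\<lambda>n. (cmod c)\<^sup>2 * (cmod (taylor_coeff f n))\<^sup>2)"
    using assms by (intro summable_mult) (simp add: hardy2_on_disk_def)
  then show "summable (\<lambda>n. (cmod (taylor_coeff (\<lambda>z. c * f z) n))\<^sup>2)"
    using assms by (simp add: hardy2_on_disk_def taylor_coeff_cmult norm_mult power_mult_distrib)
qed

lift_definition h2_scale :: "complex \<Rightarrow> hardy2 \<Rightarrow> hardy2" is "\<lambda>c f z. c * f z"
  by (simp add: hardy2_on_disk_cmult)

text \<open>The inner product is linear in its first argument.\<close>

definition h2_inner :: "hardy2 \<Rightarrow> hardy2 \<Rightarrow> complex" where
  "h2_inner F G = (\<Sum>n. h2_coeff F n * cnj (h2_coeff G n))"

lemma h2_inner_summable: "summable (\<lambda>n. h2_coeff F n * cnj (h2_coeff G n))"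
proof (rule summable_comparison_test')
  show "summable (\<lambda>n. (cmod (h2_coeff F n))\<^sup>2 + (cmod (h2_coeff G n))\<^sup>2)"
    by (intro summable_add h2_summable)
  fix n
  show "norm (h2_coeff F n * cnj (h2_coeff G n)) \<le> (cmod (h2_coeff F n))\<^sup>2 + (cmod (h2_coeff G n))\<^sup>2"
    using sum_squares_bound[of "cmod (h2_coeff F n)" "cmod (h2_coeff G n)"]
      mult_nonneg_nonneg[OF norm_ge_zero[of "h2_coeff F n"] norm_ge_zero[of "h2_coeff G n"]]
    unfolding norm_mult complex_mod_cnj by linarith
qed

instantiation hardy2 :: ab_group_add
begin

lift_definition zero_hardy2 :: hardy2 is "\<lambda>_. 0"
  by (simp add: hardy2_on_disk_def taylor_coeff_def)

lift_definition plus_hardy2 :: "hardy2 \<Rightarrow> hardy2 \<Rightarrow> hardy2" is "\<lambda>f g z. f z + g z"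
  by (simp add: hardy2_on_disk_add)

definition uminus_hardy2 :: "hardy2 \<Rightarrow> hardy2" where
  "- F = h2_scale (- 1) F"

definition minus_hardy2 :: "hardy2 \<Rightarrow> hardy2 \<Rightarrow> hardy2" where
  "F - G = F + - (G :: hardy2)"

instance
  by standard
    (auto intro!: h2_eqI simp: uminus_hardy2_def minus_hardy2_def plus_hardy2.rep_eq
      zero_hardy2.rep_eq h2_scale.rep_eq algebra_simps)

end

lemma h2_coeff_zero [simp]: "h2_coeff 0 n = 0"
  by (simp add: h2_coeff_def taylor_coeff_def zero_hardy2.rep_eq)

lemma h2_coeff_add [simp]: "h2_coeff (F + G) n = h2_coeff F n + h2_coeff G n"
  by (simp add: h2_coeff_def plus_hardy2.rep_eq taylor_coeff_add h2_holomorphic)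

lemma h2_coeff_scale [simp]: "h2_coeff (h2_scale c F) n = c * h2_coeff F n"
  by (simp add: h2_coeff_def h2_scale.rep_eq taylor_coeff_cmult h2_holomorphic)

interpretation h2: vector_space h2_scale
  by standard
    (auto intro!: h2_eqI simp: plus_hardy2.rep_eq h2_scale.rep_eq algebra_simps)

lemma h2_inner_add_left: "h2_inner (F + G) K = h2_inner F K + h2_inner G K"
  unfolding h2_inner_def
  by (simp add: distrib_right suminf_add[OF h2_inner_summable h2_inner_summable])

lemma h2_inner_scale_left: "h2_inner (h2_scale c F) G = c * h2_inner F G"
  unfolding h2_inner_def
  by (simp add: mult.assoc suminf_mult[OF h2_inner_summable])

lemma h2_inner_commute: "h2_inner F G = cnj (h2_inner G F)"
proof -
  have "(\<lambda>n. cnj (h2_coeff G n * cnj (h2_coeff F n))) sums cnj (h2_inner G F)"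
    unfolding h2_inner_def sums_cnj by (rule summable_sums[OF h2_inner_summable])
  then show ?thesis
    unfolding h2_inner_def[of F G] by (simp add: sums_iff mult.commute)
qed

lemma h2_inner_self: "h2_inner F F = complex_of_real (\<Sum>n. (cmod (h2_coeff F n))\<^sup>2)"
proof -
  have "h2_inner F F = (\<Sum>n. complex_of_real ((cmod (h2_coeff F n))\<^sup>2))"
    unfolding h2_inner_def by (simp add: complex_norm_square[symmetric] del: of_real_power)
  then show ?thesis
    by (simp only: suminf_of_real[OF h2_summable])
qed

text \<open>
  The real inner product only serves to obtain the library's norm, topology and distance to a set.
  The class constants \<open>span\<close>, \<open>dim\<close> and \<open>subspace\<close> refer to real scalars;
  the complex notions are \<open>h2.span\<close>, \<open>h2.dim\<close> and \<open>h2.subspace\<close>.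
\<close>

instantiation hardy2 :: real_inner
begin

definition scaleR_hardy2 :: "real \<Rightarrow> hardy2 \<Rightarrow> hardy2" where
  "r *\<^sub>R F = h2_scale (complex_of_real r) F"

definition inner_hardy2 :: "hardy2 \<Rightarrow> hardy2 \<Rightarrow> real" where
  "inner F G = Re (h2_inner F G)"

definition norm_hardy2 :: "hardy2 \<Rightarrow> real" where
  "norm F = sqrt (\<Sum>n. (cmod (h2_coeff F n))\<^sup>2)"

definition dist_hardy2 :: "hardy2 \<Rightarrow> hardy2 \<Rightarrow> real" where
  "dist_hardy2 F G = norm (F - G)"

definition sgn_hardy2 :: "hardy2 \<Rightarrow> hardy2" where
  "sgn_hardy2 F = inverse (norm F) *\<^sub>R F"

definition uniformity_hardy2 :: "(hardy2 \<times> hardy2) filter" where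
  "uniformity_hardy2 = (INF e\<in>{0 <..}. principal {(x, y). dist x y < e})"

definition open_hardy2 :: "hardy2 set \<Rightarrow> bool" where
  "open_hardy2 U \<longleftrightarrow> (\<forall>x\<in>U. eventually (\<lambda>(x', y). x' = x \<longrightarrow> y \<in> U) uniformity)"

instance
proof
  fix r s :: real and F G K :: hardy2
  show "r *\<^sub>R (F + G) = r *\<^sub>R F + r *\<^sub>R G" "(r + s) *\<^sub>R F = r *\<^sub>R F + s *\<^sub>R F"
    "r *\<^sub>R s *\<^sub>R F = (r * s) *\<^sub>R F" "1 *\<^sub>R F = F"
    by (simp_all add: scaleR_hardy2_def h2.scale_right_distrib h2.scale_left_distrib)
  show "dist F G = norm (F - G)" by (rule dist_hardy2_def)
  show "sgn F = inverse (norm F) *\<^sub>R F" by (rule sgn_hardy2_def)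
  show "uniformity = (INF e\<in>{0 <..}. principal {(x :: hardy2, y). dist x y < e})"
    by (rule uniformity_hardy2_def)
  show "open U \<longleftrightarrow> (\<forall>x\<in>U. eventually (\<lambda>(x', y). x' = x \<longrightarrow> y \<in> U) uniformity)"
    for U :: "hardy2 set" by (rule open_hardy2_def)
  show "inner F G = inner G F"
    unfolding inner_hardy2_def by (subst h2_inner_commute) simp
  show "inner (F + G) K = inner F K + inner G K"
    by (simp add: inner_hardy2_def h2_inner_add_left)
  show "inner (r *\<^sub>R F) G = r * inner F G"
    by (simp add: inner_hardy2_def scaleR_hardy2_def h2_inner_scale_left)
  show "0 \<le> inner F F"
    by (simp add: inner_hardy2_def h2_inner_self suminf_nonneg h2_summable)
  show "inner F F = 0 \<longleftrightarrow> F = 0"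
  proof
    assume "inner F F = 0"
    then have "\<forall>n. (cmod (h2_coeff F n))\<^sup>2 = 0"
      by (simp add: inner_hardy2_def h2_inner_self suminf_eq_zero_iff h2_summable)
    then show "F = 0"
      by (intro h2_coeff_eqI) simp
  qed (simp add: inner_hardy2_def h2_inner_def)
  show "norm F = sqrt (inner F F)"
    by (simp add: norm_hardy2_def inner_hardy2_def h2_inner_self)
qed

end

section \<open>Matrices\<close>

definition conj_transpose :: "complex^'n^'m \<Rightarrow> complex^'m^'n" where
  "conj_transpose A = (\<chi> i j. cnj (A $ j $ i))"

definition eigenvalue :: "complex^'n^'n \<Rightarrow> complex \<Rightarrow> bool" where
  "eigenvalue A c \<longleftrightarrow> (\<exists>v. v \<noteq> 0 \<and> A *v v = c *s v)"

text \<open>Only meaningful for Hermitian matrices, whose eigenvalues are real and finite in number.\<close>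

definition lambda_min :: "complex^'n^'n \<Rightarrow> real" where
  "lambda_min A = (LEAST r. eigenvalue A (complex_of_real r))"

section \<open>Optimal recovery\<close>

definition h2_orthonormal_basis :: "('n::finite \<Rightarrow> hardy2) \<Rightarrow> hardy2 set \<Rightarrow> bool" where
  "h2_orthonormal_basis V S \<longleftrightarrow>
     (\<forall>i j. h2_inner (V i) (V j) = (if i = j then 1 else 0)) \<and> h2.span (range V) = S"

definition h2_functional :: "(hardy2 \<Rightarrow> complex) \<Rightarrow> bool" where
  "h2_functional l \<longleftrightarrow> Vector_Spaces.linear h2_scale (*) l \<and> continuous_on UNIV l"

definition linearly_independent_functionals :: "('m::finite \<Rightarrow> hardy2 \<Rightarrow> complex) \<Rightarrow> bool" where
  "linearly_independent_functionals l \<longleftrightarrow>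
     (\<forall>a. (\<forall>F. (\<Sum>k\<in>UNIV. a k * l k F) = 0) \<longrightarrow> (\<forall>k. a k = 0))"

definition approx_set :: "real \<Rightarrow> hardy2 set \<Rightarrow> hardy2 set" where
  "approx_set \<epsilon> S = {F. infdist F S \<le> \<epsilon>}"

text \<open>Division in \<^typ>\<open>ennreal\<close> sends a nonzero number over zero to infinity.\<close>

definition compat :: "hardy2 set \<Rightarrow> hardy2 set \<Rightarrow> ennreal" where
  "compat N S = (SUP F\<in>N - {0}. ennreal (norm F) / ennreal (infdist F S))"

definition worst_case_error ::
  "(hardy2 \<Rightarrow> 'y) \<Rightarrow> hardy2 set \<Rightarrow> ('y \<Rightarrow> hardy2) \<Rightarrow> ennreal" where
  "worst_case_error L K A = (SUP F\<in>K. ennreal (norm (F - A (L F))))"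

end

theory Submission
  imports Defs
begin

text \<open>
  Write \<open>\<V>\<close> for the approximation space, \<open>\<W>\<close> for the span of the representers \<open>L k\<close>, and \<open>P\<close> for
  the orthogonal projection onto \<open>\<W>\<close>. The kernel of the observation map is the orthogonal complement
  of \<open>\<W>\<close>. Since \<open>H\<close> is the Gram matrix of the representers, \<open>M = G\<^sup>* H\<inverse> G\<close> is the matrix of the
  compression of \<open>P\<close> to \<open>\<V>\<close> in the orthonormal basis \<open>V\<close>: the form of \<open>M\<close> at \<open>x\<close> is
  \<open>|P v|\<^sup>2\<close> with \<open>v = \<Sum>\<^sub>j x\<^sub>j V\<^sub>j\<close> (\<open>inner_M\<close>). Hence \<open>\<lambda> = lambda_min M\<close> is the minimum of
  \<open>|P v|\<^sup>2\<close> over unit vectors \<open>v\<close> of \<open>\<V>\<close> (\<open>lambda_min_M\<close>), that is, the squared cosine of the largest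
  angle that such a vector makes with \<open>\<W>\<close>.

  If \<open>F\<close> lies in the kernel and \<open>v\<close> in \<open>\<V>\<close>, then \<open>\<langle>F, v\<rangle> = \<langle>F, v - P v\<rangle>\<close> and
  \<open>|v - P v|\<^sup>2 \<le> (1 - \<lambda>) |v|\<^sup>2\<close>, which gives \<open>|F - v|\<^sup>2 \<ge> \<lambda> |F|\<^sup>2\<close>
  (\<open>kernel_distance_lower_bound\<close>). When \<open>\<lambda> < 1\<close>, equality is attained at \<open>F = u - P u\<close> and
  \<open>v = (1 - \<lambda>) u\<close>, where \<open>u\<close> is an eigenvector belonging to \<open>\<lambda>\<close>; when \<open>\<lambda> = 1\<close>, that \<open>F\<close> vanishes, but any nonzero kernel
  element will do, and one exists because the Hardy space is infinite-dimensional
  (\<open>extremal_kernel_element\<close>). This is the formula for the compatibility constant.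

  Now let \<open>M\<close> be invertible, so that \<open>\<lambda> > 0\<close>. No map \<open>A\<close> can distinguish an extremal kernel element \<open>F\<close> from \<open>- F\<close>, so its error on one of the
  two is at least \<open>|F|\<close>; scaling \<open>F\<close> to distance at most \<open>\<epsilon>\<close> from \<open>\<V>\<close> gives the lower bound
  \<open>\<epsilon> / \<surd>\<lambda>\<close> (\<open>worst_case_error_lower_bound\<close>). Conversely the proposed output interpolates the data
  and is the sum of an element of \<open>\<V>\<close> and a correction in \<open>\<W>\<close> that is orthogonal to \<open>\<V>\<close>. The
  error is therefore in the kernel and, by Pythagoras, no farther from \<open>\<V>\<close> than \<open>F\<close> is, so the
  distance bound for kernel elements yields the matching upper bound (\<open>recovery_error_bound\<close>).
\<close>

section \<open>Synthesis, sampling and Gram matrices\<close>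

definition synth :: "('k::finite \<Rightarrow> hardy2) \<Rightarrow> complex^'k \<Rightarrow> hardy2" where
  "synth X a = (\<Sum>k\<in>UNIV. h2_scale (a $ k) (X k))"

definition samples :: "('k::finite \<Rightarrow> hardy2) \<Rightarrow> hardy2 \<Rightarrow> complex^'k" where
  "samples X F = (\<chi> k. h2_inner F (X k))"

definition gram :: "('k::finite \<Rightarrow> hardy2) \<Rightarrow> ('l::finite \<Rightarrow> hardy2) \<Rightarrow> complex^'l^'k" where
  "gram X Y = (\<chi> k j. h2_inner (Y j) (X k))"

lemma linear_synth: "linear (synth X)"
  by (rule linearI)
    (simp_all add: synth_def h2.scale_left_distrib sum.distrib scaleR_hardy2_def
      h2.scale_sum_right scaleR_conv_of_real[where 'a=complex])

lemma linear_samples: "linear (samples X)"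
  by (rule linearI)
    (simp_all add: samples_def vec_eq_iff h2_inner_add_left scaleR_hardy2_def h2_inner_scale_left
      scaleR_conv_of_real[where 'a=complex])

lemma linear_matrix_vector_mult_complex: "linear ((*v) (A :: complex^'n^'m))"
  by (rule linearI)
    (simp_all add: matrix_vector_right_distrib,
      simp add: vec_eq_iff matrix_vector_mult_def scaleR_sum_right)

lemma h2_inner_zero_left: "h2_inner 0 K = 0"
  by (simp add: h2_inner_def)

lemma h2_inner_sum_left: "h2_inner (\<Sum>k\<in>A. f k) K = (\<Sum>k\<in>A. h2_inner (f k) K)"
proof (cases "finite A")
  case True
  then show ?thesis
    by induction (simp_all add: h2_inner_add_left h2_inner_zero_left)
qed (simp add: h2_inner_zero_left)

lemma h2_inner_synth: "h2_inner (synth X a) F = (\<Sum>k\<in>UNIV. a $ k * h2_inner (X k) F)"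
  by (simp add: synth_def h2_inner_sum_left h2_inner_scale_left)

text \<open>Synthesis and sampling are adjoint. Because this already holds for the real inner products,
  the library's real norms, orthogonality and spectral arguments suffice throughout.\<close>

lemma inner_synth: "inner (synth X a) F = inner a (samples X F)"
proof -
  have "Re (z * h2_inner (X k) F) = inner z (h2_inner F (X k))" for z k
    by (subst h2_inner_commute) (simp add: inner_complex_def)
  then show ?thesis
    by (simp add: inner_hardy2_def h2_inner_synth inner_vec_def samples_def)
qed

lemma gram_mult: "gram X Y *v a = samples X (synth Y a)"
  by (simp add: gram_def samples_def vec_eq_iff matrix_vector_mult_def h2_inner_synth mult.commute)

lemma conj_transpose_gram: "conj_transpose (gram X Y) = gram Y X"
  by (simp add: conj_transpose_def gram_def vec_eq_iff h2_inner_commute[symmetric])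

lemma span_range_eq_synth: "h2.span (range X) = range (synth X)"
proof
  have "h2.subspace (range (synth X))"
  proof (rule h2.subspaceI)
    show "0 \<in> range (synth X)"
      using linear_0[OF linear_synth, of X] by (intro image_eqI[of _ _ 0]) auto
    show "F + K \<in> range (synth X)" if "F \<in> range (synth X)" "K \<in> range (synth X)" for F K
      using that by (auto simp flip: linear_add[OF linear_synth])
    show "h2_scale z F \<in> range (synth X)" if F: "F \<in> range (synth X)" for z F
    proof -
      obtain a where "F = synth X a" using F by auto
      then have "h2_scale z F = synth X (z *s a)"
        by (simp add: synth_def h2.scale_sum_right)
      then show ?thesis by simp
    qed
  qed
  moreover have "X k = synth X (axis k 1)" for k
  proof -
    have "synth X (axis k 1) = (\<Sum>j\<in>UNIV. if j = k then X j else 0)"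
      unfolding synth_def by (rule sum.cong) (auto simp: axis_def)
    then show ?thesis by simp
  qed
  then have "range X \<subseteq> range (synth X)" by auto
  ultimately show "h2.span (range X) \<subseteq> range (synth X)"
    by (rule h2.span_minimal[rotated])
  show "range (synth X) \<subseteq> h2.span (range X)"
    unfolding synth_def by (intro image_subsetI h2.span_sum h2.span_scale h2.span_base rangeI)
qed

lemma matrix_inv_cancel:
  fixes A :: "complex^'n^'n"
  assumes "invertible A"
  shows "A *v (matrix_inv A *v x) = x" "matrix_inv A *v (A *v x) = x"
  using assms someI_ex[of "\<lambda>B. A ** B = mat 1 \<and> B ** A = mat 1"]
  by (simp_all add: invertible_def matrix_inv_def matrix_vector_mul_assoc)

section \<open>The smallest eigenvalue\<close>

text \<open>The Rayleigh quotient attains its minimum on the compact unit sphere, and its first-order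
  optimality condition there is the eigenvector equation.\<close>

lemma rayleigh_minimizer_eigenvector:
  fixes f :: "'a::euclidean_space \<Rightarrow> 'a"
  assumes lin: "linear f" and self_adjoint: "\<And>x y. inner (f x) y = inner x (f y)"
  obtains u r where "norm u = 1" "f u = r *\<^sub>R u" "\<And>x. r * (norm x)\<^sup>2 \<le> inner (f x) x"
proof -
  have cont: "continuous_on (sphere 0 1) (\<lambda>x. inner (f x) x)"
    by (intro continuous_on_inner linear_continuous_on continuous_on_id
        linear_conv_bounded_linear[THEN iffD1] lin)
  have "sphere (0::'a) 1 \<noteq> {}" by simp
  then obtain u where u: "u \<in> sphere 0 1"
    and least: "\<And>x. x \<in> sphere 0 1 \<Longrightarrow> inner (f u) u \<le> inner (f x) x"
    using continuous_attains_inf[OF compact_sphere _ cont] by blast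
  define r where "r = inner (f u) u"
  have bound: "r * (norm x)\<^sup>2 \<le> inner (f x) x" for x
  proof (cases "x = 0")
    case False
    have "r \<le> inner (f (x /\<^sub>R norm x)) (x /\<^sub>R norm x)"
      unfolding r_def by (rule least) (simp add: False)
    also have "\<dots> = inner (f x) x / (norm x)\<^sup>2"
      by (simp add: linear_cmul[OF lin] power2_eq_square field_simps)
    finally show ?thesis using False by (simp add: field_simps)
  qed (simp add: linear_0[OF lin])
  define w where "w = f u - r *\<^sub>R u"
  have nu: "norm u = 1" using u by simp
  then have uu: "inner u u = 1" by (simp add: dot_square_norm)
  define C where "C = inner (f w) w - r * inner w w"
  (* The form x. f x - r |x|^2 is nonnegative and vanishes at u; along u + t w it is
     2 t |w|^2 + t^2 C, which would be negative for small t < 0 unless w = 0. *)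
  have quad: "0 \<le> t * (2 * inner w w + t * C)" for t
  proof -
    have fuw: "inner (f u) w = inner w w + r * inner u w"
      unfolding w_def by (simp add: inner_diff_left inner_diff_right algebra_simps)
    have "r * inner (u + t *\<^sub>R w) (u + t *\<^sub>R w) \<le> inner (f (u + t *\<^sub>R w)) (u + t *\<^sub>R w)"
      using bound by (simp add: dot_square_norm)
    moreover have "inner (f w) u = inner (f u) w"
      by (metis self_adjoint inner_commute)
    ultimately show ?thesis
      by (simp add: linear_add[OF lin] linear_cmul[OF lin] inner_add_left inner_add_right
          r_def[symmetric] uu fuw C_def inner_commute[of w u] algebra_simps)
  qed
  have "w = 0"
  proof (rule ccontr)
    assume "w \<noteq> 0"
    then have pos: "0 < inner w w" by simp
    define t where "t = - inner w w / (\<bar>C\<bar> + 1)"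
    have "t < 0" using pos by (simp add: t_def divide_neg_pos)
    have "- t * C \<le> - t * \<bar>C\<bar>" using \<open>t < 0\<close> by (intro mult_left_mono) auto
    also have "\<dots> \<le> inner w w"
      using pos by (simp add: t_def field_simps)
    finally have "- t * C \<le> inner w w" .
    moreover have "- t * C \<ge> - inner w w"
    proof -
      have "- t * - \<bar>C\<bar> \<le> - t * C" using \<open>t < 0\<close> by (intro mult_left_mono) auto
      moreover have "- t * \<bar>C\<bar> \<le> inner w w" using pos by (simp add: t_def field_simps)
      ultimately show ?thesis by linarith
    qed
    ultimately have "0 < 2 * inner w w + t * C" using pos by linarith
    with quad[of t] \<open>t < 0\<close> show False by (simp add: zero_le_mult_iff)
  qed
  then have "f u = r *\<^sub>R u" by (simp add: w_def)
  with nu bound show thesis by (intro that)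
qed

text \<open>A real eigenvalue is a value of the Rayleigh quotient, so it cannot lie below the minimum, which
  is itself an eigenvalue; this makes the \<open>LEAST\<close> operator in the definition of \<^const>\<open>lambda_min\<close>
  well-behaved.\<close>

lemma lambda_min_rayleigh:
  fixes A :: "complex^'n^'n"
  assumes self_adjoint: "\<And>x y. inner (A *v x) y = inner x (A *v y)"
  obtains u where "norm u = 1" "A *v u = lambda_min A *\<^sub>R u"
    "\<And>x. lambda_min A * (norm x)\<^sup>2 \<le> inner (A *v x) x"
proof -
  obtain u r where u: "norm u = 1" "A *v u = r *\<^sub>R u"
    and bound: "\<And>x. r * (norm x)\<^sup>2 \<le> inner (A *v x) x"
    using rayleigh_minimizer_eigenvector[OF linear_matrix_vector_mult_complex self_adjoint] by blast
  have scale: "of_real s *s x = s *\<^sub>R x" for s and x :: "complex^'n"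
    by (simp add: vec_eq_iff scaleR_conv_of_real[where 'a=complex])
  have "lambda_min A = r"
    unfolding lambda_min_def
  proof (rule Least_equality)
    show "eigenvalue A (of_real r)"
      unfolding eigenvalue_def scale using u by (intro exI[of _ u]) auto
    fix s assume "eigenvalue A (of_real s)"
    then obtain x where "x \<noteq> 0" "A *v x = s *\<^sub>R x"
      unfolding eigenvalue_def scale by auto
    with bound[of x] show "r \<le> s"
      by (simp add: power2_norm_eq_inner)
  qed
  with u bound show thesis by (intro that) auto
qed

section \<open>Infinite dimension of the Hardy space\<close>

lemma taylor_coeff_monomial:
  "taylor_coeff (\<lambda>z. if z \<in> ball 0 1 then z ^ k else 0) n = (if n = k then 1 else 0)"
proof -
  have "(deriv ^^ n) (\<lambda>z. if z \<in> ball 0 1 then z ^ k else 0) 0 = (deriv ^^ n) (\<lambda>z. (z - 0) ^ k) (0::complex)"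
    by (rule higher_deriv_cong_ev) (auto intro!: eventually_mono[OF eventually_nhds_in_open[of "ball 0 1"]])
  also have "\<dots> = pochhammer (of_nat (Suc k - n)) n * 0 ^ (k - n)"
    by (subst higher_deriv_power) simp
  also have "\<dots> = (if n = k then fact n else 0)"
    by (auto simp: pochhammer_0_left pochhammer_fact not_less power_0_left)
  finally show ?thesis by (simp add: taylor_coeff_def)
qed

lemma exists_monomial: "\<exists>F. \<forall>n. h2_coeff F n = (if n = k then 1 else 0)"
proof -
  let ?f = "\<lambda>z::complex. if z \<in> ball 0 1 then z ^ k else 0"
  have "?f holomorphic_on ball 0 1"
    by (subst holomorphic_cong[OF refl, where g = "\<lambda>z. z ^ k"]) (auto intro!: holomorphic_intros)
  moreover have "summable (\<lambda>n. (cmod (taylor_coeff ?f n))\<^sup>2)"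
    unfolding taylor_coeff_monomial by (rule summable_finite[of "{k}"]) auto
  ultimately have "?f \<in> {f. hardy2_on_disk f \<and> (\<forall>z. z \<notin> ball 0 1 \<longrightarrow> f z = 0)}"
    by (simp add: hardy2_on_disk_def)
  then have "h2_eval (Abs_hardy2 ?f) = ?f" by (rule Abs_hardy2_inverse)
  then show ?thesis
    by (intro exI[of _ "Abs_hardy2 ?f"]) (simp only: h2_coeff_def taylor_coeff_monomial, simp)
qed

text \<open>The monomials form an infinite orthonormal family, whereas the range of a synthesis map is
  spanned over the reals by the images of finitely many basis vectors.\<close>

lemma range_synth_ne_UNIV: "\<exists>F. F \<notin> range (synth X)"
proof (rule ccontr)
  assume "\<not> ?thesis"
  then have all: "range (synth X) = UNIV" by blast
  obtain e where e: "\<And>k n. h2_coeff (e k) n = (if n = k then 1 else 0)"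
    using exists_monomial by metis
  have inner_e: "inner (e i) (e j) = (if i = j then 1 else 0)" for i j
  proof -
    have "h2_inner (e i) (e j) = (\<Sum>n\<in>{i}. h2_coeff (e i) n * cnj (h2_coeff (e j) n))"
      unfolding h2_inner_def by (rule suminf_finite) (auto simp: e)
    then show ?thesis by (simp add: inner_hardy2_def e)
  qed
  have inj: "inj e"
    using inner_e by (metis injI zero_neq_one)
  have "pairwise orthogonal (range e)"
    by (auto simp: pairwise_def orthogonal_def inner_e)
  moreover have "0 \<notin> range e" using inner_e by (metis imageE inner_zero_left zero_neq_one)
  ultimately have "independent (range e)" by (rule pairwise_orthogonal_independent)
  moreover have "range (synth X) = span (synth X ` Basis)"
    using linear_span_image[OF linear_synth, of X Basis] by simp
  ultimately have "finite (range e)"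
    using independent_span_bound[of "synth X ` Basis" "range e"] all by auto
  with inj show False using finite_imageD by blast
qed

section \<open>Compatibility constants and worst-case errors\<close>

lemma le_infdistI:
  assumes "S \<noteq> {}" "\<And>v. v \<in> S \<Longrightarrow> r \<le> dist F v"
  shows "r \<le> infdist F S"
  using assms by (simp add: infdist_notempty cINF_greatest)

text \<open>The bound \<open>s\<close> may be zero: the attaining element is then at distance zero and both sides are
  infinite.\<close>

lemma compat_eqI:
  assumes "0 \<le> s"
    and lower: "\<And>F. F \<in> N \<Longrightarrow> s * norm F \<le> infdist F S"
    and attained: "F0 \<in> N" "F0 \<noteq> 0" "infdist F0 S \<le> s * norm F0"
  shows "compat N S = 1 / ennreal s"
  unfolding compat_def
proof (rule antisym)
  show "(SUP F\<in>N - {0}. ennreal (norm F) / ennreal (infdist F S)) \<le> 1 / ennreal s"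
  proof (rule SUP_least)
    fix F assume F: "F \<in> N - {0}"
    show "ennreal (norm F) / ennreal (infdist F S) \<le> 1 / ennreal s"
    proof (cases "s = 0")
      case False
      with \<open>0 \<le> s\<close> have "0 < s" by simp
      with F have "0 < s * norm F" by simp
      with lower[of F] F have "0 < infdist F S" by simp
      moreover from this have "norm F / infdist F S \<le> 1 / s"
        using lower[of F] F \<open>0 < s\<close> by (simp add: field_simps)
      ultimately show ?thesis
        using \<open>0 < s\<close> by (simp add: divide_ennreal flip: ennreal_1)
    qed simp
  qed
  have "1 / ennreal s \<le> ennreal (norm F0) / ennreal (infdist F0 S)"
  proof (cases "infdist F0 S = 0")
    case False
    then have pos: "0 < infdist F0 S" using infdist_nonneg[of F0 S] by linarith
    with attained have "0 < s" by (smt (verit) mult_nonpos_nonneg norm_ge_zero)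
    have "1 / s \<le> norm F0 / infdist F0 S"
      using pos \<open>0 < s\<close> attained by (simp add: field_simps)
    then show ?thesis
      using pos \<open>0 < s\<close> by (simp add: divide_ennreal flip: ennreal_1)
  qed (use attained in simp)
  also have "\<dots> \<le> (SUP F\<in>N - {0}. ennreal (norm F) / ennreal (infdist F S))"
    by (rule SUP_upper) (use attained in simp)
  finally show "1 / ennreal s \<le> (SUP F\<in>N - {0}. ennreal (norm F) / ennreal (infdist F S))" .
qed

text \<open>The single output for the common data of \<open>F\<close> and \<open>- F\<close> cannot be closer than \<open>|F|\<close> to
  both, since they are \<open>2 |F|\<close> apart.\<close>

lemma worst_case_error_ge:
  assumes "F \<in> K" "- F \<in> K" "obs (- F) = obs F"
  shows "ennreal (norm F) \<le> worst_case_error obs K A"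
proof -
  let ?P = "A (obs F)"
  have "2 * norm F = norm ((F - ?P) - (- F - ?P))"
    by (simp add: mult_2[symmetric] flip: scaleR_2)
  also have "\<dots> \<le> norm (F - ?P) + norm (- F - ?P)"
    by (rule norm_triangle_ineq4)
  finally have "norm F \<le> norm (F - ?P) \<or> norm F \<le> norm (- F - ?P)" by linarith
  moreover have "ennreal (norm (F - ?P)) \<le> worst_case_error obs K A"
    unfolding worst_case_error_def by (rule SUP_upper[OF assms(1)])
  moreover have "ennreal (norm (- F - ?P)) \<le> worst_case_error obs K A"
    unfolding worst_case_error_def using SUP_upper[OF assms(2), of "\<lambda>F. ennreal (norm (F - A (obs F)))"]
    by (simp only: assms(3))
  ultimately show ?thesis by (meson ennreal_leI order_trans)
qed

section \<open>The recovery problem\<close>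

locale recovery =
  fixes V :: "'n::finite \<Rightarrow> hardy2" and L :: "'m::finite \<Rightarrow> hardy2"
  assumes orthonormal: "\<And>i j. h2_inner (V i) (V j) = (if i = j then 1 else 0)"
    and independent: "\<And>a. synth L a = 0 \<Longrightarrow> a = 0"
begin

definition M :: "complex^'n^'n" where
  "M = gram V L ** matrix_inv (gram L L) ** gram L V"

text \<open>This solves the normal equations for the representers, so it is the orthogonal projection onto
  their span.\<close>

definition proj :: "hardy2 \<Rightarrow> hardy2" where
  "proj F = synth L (matrix_inv (gram L L) *v samples L F)"

definition coef :: "complex^'m \<Rightarrow> complex^'n" where
  "coef y = (matrix_inv M ** gram V L ** matrix_inv (gram L L)) *v y"

definition correction :: "complex^'m \<Rightarrow> complex^'m" where
  "correction y = matrix_inv (gram L L) *v (y - gram L V *v coef y)"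

definition recover :: "complex^'m \<Rightarrow> hardy2" where
  "recover y = synth V (coef y) + synth L (correction y)"

lemma invertible_gram: "invertible (gram L L)"
proof -
  have "a = 0" if "gram L L *v a = 0" for a
  proof -
    have "inner (synth L a) (synth L a) = 0"
      using that by (simp add: inner_synth gram_mult)
    then show ?thesis using independent by simp
  qed
  then show ?thesis
    by (simp add: invertible_left_inverse matrix_left_invertible_ker)
qed

lemma samples_proj: "samples L (proj F) = samples L F"
  by (simp add: proj_def matrix_inv_cancel[OF invertible_gram] flip: gram_mult)

lemma residual_orthogonal: "inner (F - proj F) (synth L a) = 0"
  by (subst inner_commute)
    (simp add: inner_synth linear_diff[OF linear_samples] samples_proj)

lemma inner_proj_left: "inner (proj F) K = inner (proj F) (proj K)"
  using residual_orthogonal[of K "matrix_inv (gram L L) *v samples L F"]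
  by (simp add: proj_def[symmetric] inner_diff_right inner_commute[of _ "proj F"])

lemma norm_residual: "(norm (F - proj F))\<^sup>2 = (norm F)\<^sup>2 - (norm (proj F))\<^sup>2"
proof -
  have "inner F (proj F) = inner (proj F) (proj F)"
    using inner_proj_left[of F F] by (simp add: inner_commute)
  then show ?thesis
    by (simp add: power2_norm_eq_inner inner_diff_left inner_diff_right inner_commute)
qed

lemma samples_synth_V: "samples V (synth V x) = x"
  by (simp add: samples_def h2_inner_synth orthonormal vec_eq_iff if_distrib cong: if_cong)

lemma norm_synth_V: "norm (synth V x) = norm x"
  by (simp add: norm_eq_sqrt_inner inner_synth samples_synth_V)

lemma M_mult: "M *v x = samples V (proj (synth V x))"
  by (simp add: M_def proj_def gram_mult flip: matrix_vector_mul_assoc)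

text \<open>The compression of the projection onto the representers to the approximation space has matrix
  \<^const>\<open>M\<close>, so all spectral information about \<^const>\<open>M\<close> is about angles between the two spaces.\<close>

lemma inner_M: "inner (M *v x) y = inner (proj (synth V x)) (proj (synth V y))"
proof -
  have "inner (M *v x) y = inner (synth V y) (proj (synth V x))"
    by (simp add: M_mult inner_synth inner_commute)
  also have "\<dots> = inner (proj (synth V x)) (proj (synth V y))"
    by (subst inner_commute) (rule inner_proj_left)
  finally show ?thesis .
qed

lemma lambda_min_M:
  obtains u where "norm u = 1" "M *v u = lambda_min M *\<^sub>R u"
    "\<And>x. lambda_min M * (norm x)\<^sup>2 \<le> (norm (proj (synth V x)))\<^sup>2"
    "(norm (proj (synth V u)))\<^sup>2 = lambda_min M"
proof -
  have "inner (M *v x) y = inner x (M *v y)" for x y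
    using inner_M[of x y] inner_M[of y x] by (simp add: inner_commute)
  then obtain u where u: "norm u = 1" "M *v u = lambda_min M *\<^sub>R u"
    and "\<And>x. lambda_min M * (norm x)\<^sup>2 \<le> inner (M *v x) x"
    using lambda_min_rayleigh[of M] by blast
  then have bound: "\<And>x. lambda_min M * (norm x)\<^sup>2 \<le> (norm (proj (synth V x)))\<^sup>2"
    by (simp add: inner_M power2_norm_eq_inner)
  have "inner (M *v u) u = lambda_min M"
    using u by (simp add: dot_square_norm)
  then have "(norm (proj (synth V u)))\<^sup>2 = lambda_min M"
    by (simp add: inner_M power2_norm_eq_inner)
  with u bound show thesis by (intro that)
qed

lemma lambda_min_nonneg: "0 \<le> lambda_min M"
  by (metis lambda_min_M zero_le_power2)

lemma lambda_min_le_1: "lambda_min M \<le> 1"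
proof -
  obtain u where u: "norm u = 1" "(norm (proj (synth V u)))\<^sup>2 = lambda_min M"
    using lambda_min_M by blast
  have "0 \<le> (norm (synth V u - proj (synth V u)))\<^sup>2" by simp
  then show ?thesis
    unfolding norm_residual norm_synth_V u by simp
qed

text \<open>A kernel element sees only the part of \<open>v\<close> that is orthogonal to the representers, and the
  norm of that part is at most \<open>sqrt (1 - lambda_min M)\<close> times the norm of \<open>v\<close>.\<close>

lemma kernel_distance_lower_bound:
  assumes "samples L F = 0"
  shows "sqrt (lambda_min M) * norm F \<le> norm (F - synth V x)"
proof -
  let ?v = "synth V x" and ?s = "sqrt (1 - lambda_min M)"
  have "inner F ?v = inner F (?v - proj ?v)"
    using assms by (simp add: inner_diff_right proj_def inner_commute[of F "synth L _"] inner_synth)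
  also have "\<dots> \<le> norm F * norm (?v - proj ?v)"
    by (rule norm_cauchy_schwarz)
  also have "\<dots> \<le> norm F * (?s * norm x)"
  proof (rule mult_left_mono[OF power2_le_imp_le])
    have "lambda_min M * (norm x)\<^sup>2 \<le> (norm (proj ?v))\<^sup>2"
      using lambda_min_M by blast
    then show "(norm (?v - proj ?v))\<^sup>2 \<le> (?s * norm x)\<^sup>2"
      using lambda_min_le_1 by (simp add: norm_residual norm_synth_V power_mult_distrib algebra_simps)
  qed (use lambda_min_le_1 in auto)
  finally have ip: "inner F ?v \<le> norm F * (?s * norm x)" .
  (* With f = |F| and t = |x|: f^2 - 2 f s t + t^2 = (1 - s^2) f^2 + (t - s f)^2. *)
  have s2: "?s\<^sup>2 = 1 - lambda_min M" using lambda_min_le_1 by simp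
  have "(norm (F - ?v))\<^sup>2 = (norm F)\<^sup>2 - 2 * inner F ?v + (norm x)\<^sup>2"
    unfolding norm_synth_V[symmetric]
    by (simp add: power2_norm_eq_inner inner_diff_left inner_diff_right inner_commute)
  also have "\<dots> \<ge> (norm F)\<^sup>2 - 2 * (norm F * (?s * norm x)) + (norm x)\<^sup>2"
    using ip by simp
  also have "(norm F)\<^sup>2 - 2 * (norm F * (?s * norm x)) + (norm x)\<^sup>2
      = (1 - ?s\<^sup>2) * (norm F)\<^sup>2 + (norm x - ?s * norm F)\<^sup>2"
    by (simp add: power2_eq_square algebra_simps)
  finally have "(1 - ?s\<^sup>2) * (norm F)\<^sup>2 \<le> (norm (F - ?v))\<^sup>2"
    by (smt (verit) zero_le_power2)
  then have "(sqrt (lambda_min M) * norm F)\<^sup>2 \<le> (norm (F - ?v))\<^sup>2"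
    using lambda_min_nonneg unfolding s2 by (simp add: power_mult_distrib)
  then show ?thesis by (rule power2_le_imp_le) simp
qed

text \<open>Unless the smallest eigenvalue is 1, the residual of an eigenvector belonging to it is extremal:
  among the vectors of the approximation space, these make the largest angle with the representers.\<close>

lemma extremal_kernel_element:
  obtains F x where "samples L F = 0" "F \<noteq> 0"
    "norm (F - synth V x) \<le> sqrt (lambda_min M) * norm F"
proof (cases "lambda_min M = 1")
  case True
  obtain K where "K \<notin> range (synth L)" using range_synth_ne_UNIV by blast
  (* Here the approximation space lies in the span of the representers, so eigenvectors have zero
     residual; the zero vector of the approximation space already gives the ratio 1. *)
  then have "K - proj K \<noteq> 0" by (auto simp: proj_def)
  moreover have "samples L (K - proj K) = 0"
    by (simp add: linear_diff[OF linear_samples] samples_proj)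
  ultimately show thesis
    using True by (intro that[of "K - proj K" 0]) (simp_all add: linear_0[OF linear_synth])
next
  case False
  obtain u where u: "norm u = 1" "M *v u = lambda_min M *\<^sub>R u"
    and Pu: "(norm (proj (synth V u)))\<^sup>2 = lambda_min M"
    using lambda_min_M by blast
  let ?v = "synth V u"
  let ?F = "?v - proj ?v"
  have nF: "(norm ?F)\<^sup>2 = 1 - lambda_min M"
    by (simp add: norm_residual norm_synth_V u Pu)
  have vv: "inner ?v ?v = 1" by (simp add: dot_square_norm norm_synth_V u)
  have PP: "inner (proj ?v) (proj ?v) = lambda_min M"
    using Pu by (simp add: dot_square_norm)
  have vP: "inner ?v (proj ?v) = lambda_min M"
    using inner_proj_left[of ?v ?v] PP by (simp add: inner_commute)
  (* Projecting F = v - P v to the approximation space gives (1 - lambda) v, because P v projects to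
     lambda v by the eigenvector equation. *)
  have "?F - synth V ((1 - lambda_min M) *\<^sub>R u) = lambda_min M *\<^sub>R ?v - proj ?v"
    by (simp add: linear_cmul[OF linear_synth] linear_diff[OF linear_synth] scaleR_diff_left)
  then have "(norm (?F - synth V ((1 - lambda_min M) *\<^sub>R u)))\<^sup>2
      = (norm (lambda_min M *\<^sub>R ?v - proj ?v))\<^sup>2"
    by (simp only:)
  also have "\<dots> = lambda_min M * (1 - lambda_min M)"
    by (simp add: power2_norm_eq_inner inner_diff_left inner_diff_right vv PP vP
        inner_commute[of "proj ?v" ?v] algebra_simps)
  also have "\<dots> = (sqrt (lambda_min M) * norm ?F)\<^sup>2"
    using lambda_min_nonneg by (simp add: power_mult_distrib nF)
  finally have "norm (?F - synth V ((1 - lambda_min M) *\<^sub>R u)) \<le> sqrt (lambda_min M) * norm ?F"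
    by (rule power2_le_imp_le[OF eq_refl]) (simp add: lambda_min_nonneg)
  moreover have "?F \<noteq> 0" using nF False by auto
  moreover have "samples L ?F = 0"
    by (simp add: linear_diff[OF linear_samples] samples_proj)
  ultimately show thesis by (intro that)
qed

lemma compat_kernel:
  "compat {F. samples L F = 0} (range (synth V)) = 1 / ennreal (sqrt (lambda_min M))"
proof -
  obtain F x where F: "samples L F = 0" "F \<noteq> 0"
    "norm (F - synth V x) \<le> sqrt (lambda_min M) * norm F"
    by (rule extremal_kernel_element)
  show ?thesis
  proof (rule compat_eqI[where ?F0.0 = F])
    show "sqrt (lambda_min M) * norm K \<le> infdist K (range (synth V))"
      if "K \<in> {F. samples L F = 0}" for K
      using that kernel_distance_lower_bound by (intro le_infdistI) (auto simp: dist_norm)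
    show "infdist F (range (synth V)) \<le> sqrt (lambda_min M) * norm F"
      using F(3) by (intro infdist_le2[of "synth V x"]) (auto simp: dist_norm)
  qed (use F lambda_min_nonneg in auto)
qed

lemma lambda_min_pos:
  assumes "invertible M"
  shows "0 < lambda_min M"
proof -
  obtain u where u: "norm u = 1" "M *v u = lambda_min M *\<^sub>R u"
    using lambda_min_M by blast
  have "lambda_min M \<noteq> 0"
  proof
    assume "lambda_min M = 0"
    then have "M *v u = 0" using u by simp
    then have "u = 0" using matrix_inv_cancel(2)[OF assms, of u] by simp
    then show False using u by simp
  qed
  with lambda_min_nonneg show ?thesis by simp
qed

lemma samples_recover: "samples L (recover y) = y"
  by (simp add: recover_def linear_add[OF linear_samples] correction_def matrix_inv_cancel[OF invertible_gram]
      flip: gram_mult)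

text \<open>The equation defining \<^const>\<open>coef\<close> says exactly that the correction term is orthogonal to the
  approximation space.\<close>

lemma samples_V_correction:
  assumes "invertible M"
  shows "samples V (synth L (correction y)) = 0"
proof -
  have "samples V (synth L (correction y))
      = gram V L *v (matrix_inv (gram L L) *v y) - M *v coef y"
    by (simp add: correction_def M_def matrix_vector_mult_diff_distrib flip: gram_mult matrix_vector_mul_assoc)
  also have "M *v coef y = gram V L *v (matrix_inv (gram L L) *v y)"
    by (simp add: coef_def matrix_inv_cancel[OF assms] flip: matrix_vector_mul_assoc)
  finally show ?thesis by simp
qed

text \<open>The error \<open>F - recover (samples L F)\<close> lies in the kernel, hence is orthogonal to the correction
  term, as is the approximation space. For each \<open>W\<close> in that space, \<open>F - W\<close> is the correction term plus
  a vector \<open>B\<close> that differs from the error by an element of the space; by Pythagoras \<open>B\<close> is no longer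
  than \<open>F - W\<close>.\<close>

lemma recovery_error_bound:
  assumes "invertible M"
  shows "sqrt (lambda_min M) * norm (F - recover (samples L F)) \<le> infdist F (range (synth V))"
proof (rule le_infdistI)
  fix W assume "W \<in> range (synth V)"
  then obtain x where W: "W = synth V x" by auto
  define y where "y = samples L F"
  let ?E = "F - recover y" and ?q = "synth L (correction y)"
  have kernel: "samples L ?E = 0"
    by (simp add: linear_diff[OF linear_samples] samples_recover y_def)
  define B where "B = ?E - synth V (x - coef y)"
  have "inner ?q B = inner ?q ?E - inner (synth V (x - coef y)) ?q"
    by (simp add: B_def inner_diff_right inner_commute)
  also have "\<dots> = inner (correction y) (samples L ?E) - inner (x - coef y) (samples V ?q)"
    by (simp only: inner_synth)
  finally have orth: "inner ?q B = 0"
    by (simp add: kernel samples_V_correction[OF assms])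
  have "F - W = B + ?q"
    by (simp add: B_def W recover_def linear_diff[OF linear_synth])
  then have "(norm (F - W))\<^sup>2 = (norm B)\<^sup>2 + (norm ?q)\<^sup>2"
    using orth by (simp add: power2_norm_eq_inner inner_add_left inner_add_right inner_commute)
  then have "norm B \<le> norm (F - W)"
    by (simp add: power2_le_imp_le)
  with kernel_distance_lower_bound[OF kernel, of "x - coef y"]
  show "sqrt (lambda_min M) * norm (F - recover (samples L F)) \<le> dist F W"
    by (simp add: B_def y_def dist_norm)
qed simp

lemma worst_case_error_recover_le:
  assumes "invertible M" "0 < \<epsilon>"
  shows "worst_case_error (samples L) (approx_set \<epsilon> (range (synth V))) recover
    \<le> ennreal (\<epsilon> / sqrt (lambda_min M))"
  unfolding worst_case_error_def
proof (intro SUP_least ennreal_leI)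
  fix F assume "F \<in> approx_set \<epsilon> (range (synth V))"
  then have "sqrt (lambda_min M) * norm (F - recover (samples L F)) \<le> \<epsilon>"
    using recovery_error_bound[OF assms(1), of F] by (simp add: approx_set_def)
  then show "norm (F - recover (samples L F)) \<le> \<epsilon> / sqrt (lambda_min M)"
    using lambda_min_pos[OF assms(1)] by (simp add: field_simps)
qed

lemma worst_case_error_lower_bound:
  assumes "invertible M" "0 < \<epsilon>"
  shows "ennreal (\<epsilon> / sqrt (lambda_min M))
    \<le> worst_case_error (samples L) (approx_set \<epsilon> (range (synth V))) A"
proof -
  obtain F x where F: "samples L F = 0" "F \<noteq> 0"
    "norm (F - synth V x) \<le> sqrt (lambda_min M) * norm F"
    by (rule extremal_kernel_element)
  define s where "s = sqrt (lambda_min M)"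
  have s: "0 < s" using lambda_min_pos[OF assms(1)] by (simp add: s_def)
  define r where "r = \<epsilon> / (s * norm F)"
  have r: "0 < r" using s F assms by (simp add: r_def)
  have in_K: "t *\<^sub>R F \<in> approx_set \<epsilon> (range (synth V))" if "\<bar>t\<bar> = r" for t
  proof -
    have "norm (t *\<^sub>R F - synth V (t *\<^sub>R x)) = r * norm (F - synth V x)"
      using that by (simp add: linear_cmul[OF linear_synth] flip: scaleR_diff_right)
    also have "\<dots> \<le> r * (s * norm F)"
      using F r by (intro mult_left_mono) (auto simp: s_def)
    also have "\<dots> = \<epsilon>" using s F by (simp add: r_def)
    finally show ?thesis
      unfolding approx_set_def mem_Collect_eq
      by (intro infdist_le2[of "synth V (t *\<^sub>R x)"]) (auto simp: dist_norm)
  qed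
  have "ennreal (norm (r *\<^sub>R F)) \<le> worst_case_error (samples L) (approx_set \<epsilon> (range (synth V))) A"
    using in_K[of r] in_K[of "- r"] r
    by (intro worst_case_error_ge)
      (simp_all add: linear_cmul[OF linear_samples] linear_neg[OF linear_samples] F)
  also have "norm (r *\<^sub>R F) = \<epsilon> / s"
    using r s F assms by (simp add: r_def)
  finally show ?thesis by (simp add: s_def)
qed

lemma recovery_optimal:
  assumes "invertible M" "0 < \<epsilon>"
  shows "worst_case_error (samples L) (approx_set \<epsilon> (range (synth V))) recover
      = (INF A. worst_case_error (samples L) (approx_set \<epsilon> (range (synth V))) A)"
    and "worst_case_error (samples L) (approx_set \<epsilon> (range (synth V))) recover
      = compat {F. samples L F = 0} (range (synth V)) * ennreal \<epsilon>"
proof -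
  let ?E = "worst_case_error (samples L) (approx_set \<epsilon> (range (synth V)))"
  show "?E recover = (INF A. ?E A)"
    by (intro antisym INF_greatest INF_lower UNIV_I
        order_trans[OF worst_case_error_recover_le[OF assms] worst_case_error_lower_bound[OF assms]])
  have "?E recover = ennreal (\<epsilon> / sqrt (lambda_min M))"
    by (intro antisym worst_case_error_recover_le worst_case_error_lower_bound assms)
  also have "\<dots> = compat {F. samples L F = 0} (range (synth V)) * ennreal \<epsilon>"
    unfolding compat_kernel using lambda_min_pos[OF assms(1)] assms(2)
    by (simp add: divide_ennreal flip: ennreal_1 ennreal_mult)
  finally show "?E recover = compat {F. samples L F = 0} (range (synth V)) * ennreal \<epsilon>" .
qed

end

section \<open>Recovery from linear functionals\<close>

lemma riesz_representers_independent:
  assumes "linearly_independent_functionals l"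
    and "\<And>k F. l k F = h2_inner F (L k)" and "synth L a = 0"
  shows "a = 0"
proof -
  have "(\<Sum>k\<in>UNIV. cnj (a $ k) * l k F) = cnj (h2_inner (synth L a) F)" for F
    by (simp add: h2_inner_synth assms(2) h2_inner_commute[symmetric])
  then have "\<forall>F. (\<Sum>k\<in>UNIV. cnj (a $ k) * l k F) = 0"
    by (simp add: assms(3) h2_inner_def)
  then have "cnj (a $ k) = 0" for k
    using assms(1) unfolding linearly_independent_functionals_def
    by (elim allE[of _ "\<lambda>k. cnj (a $ k)"]) blast
  then show ?thesis by (simp add: vec_eq_iff)
qed

theorem theorem1:
  fixes S :: "hardy2 set"
    and V :: "'n::finite \<Rightarrow> hardy2"
    and l :: "'m::finite \<Rightarrow> hardy2 \<Rightarrow> complex"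
    and L :: "'m \<Rightarrow> hardy2"
    and obs :: "hardy2 \<Rightarrow> complex^'m"
    and G :: "complex^'n^'m"
    and H :: "complex^'m^'m"
    and M :: "complex^'n^'n"
    and c :: "complex^'m \<Rightarrow> complex^'n"
    and d :: "complex^'m \<Rightarrow> complex^'m"
    and A_opt :: "complex^'m \<Rightarrow> hardy2"
  assumes S_subspace: "h2.subspace S"
    and S_dim: "h2.dim S = CARD('n)"
    and V_basis: "h2_orthonormal_basis V S"
    and n_le_m: "CARD('n) \<le> CARD('m)"
    and l_functional: "\<And>k. h2_functional (l k)"
    and l_indep: "linearly_independent_functionals l"
    and L_riesz: "\<And>k F. l k F = h2_inner F (L k)"
    and obs_def: "obs = (\<lambda>F. \<chi> k. l k F)"
    and G_def: "G = (\<chi> k j. l k (V j))"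
    and H_def: "H = (\<chi> k j. l k (L j))"
    and M_def: "M = conj_transpose G ** matrix_inv H ** G"
    and c_def: "c = (\<lambda>y. (matrix_inv M ** conj_transpose G ** matrix_inv H) *v y)"
    and d_def: "d = (\<lambda>y. matrix_inv H *v (y - G *v c y))"
    and A_opt_def: "A_opt = (\<lambda>y. (\<Sum>j\<in>UNIV. h2_scale (c y $ j) (V j))
                               + (\<Sum>k\<in>UNIV. h2_scale (d y $ k) (L k)))"
  shows "compat {F. obs F = 0} S = 1 / ennreal (sqrt (lambda_min M)) \<and>
    (invertible M \<longrightarrow> (\<forall>\<epsilon>>0.
      worst_case_error obs (approx_set \<epsilon> S) A_opt = (INF A. worst_case_error obs (approx_set \<epsilon> S) A) \<and>
      worst_case_error obs (approx_set \<epsilon> S) A_opt = compat {F. obs F = 0} S * ennreal \<epsilon>))"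
proof -
  interpret R: recovery V L
    using V_basis riesz_representers_independent[OF l_indep L_riesz]
    by unfold_locales (auto simp: h2_orthonormal_basis_def)
  have obs: "obs = samples L"
    by (simp add: obs_def samples_def L_riesz fun_eq_iff)
  have S: "S = range (synth V)"
    using V_basis by (simp add: h2_orthonormal_basis_def span_range_eq_synth)
  have G: "G = gram L V" and H: "H = gram L L"
    by (simp_all add: G_def H_def gram_def L_riesz)
  have M: "M = R.M"
    by (simp add: M_def R.M_def G H conj_transpose_gram)
  have c: "c = R.coef"
    by (simp add: c_def R.coef_def G H M conj_transpose_gram fun_eq_iff)
  have d: "d = R.correction"
    by (simp add: d_def R.correction_def G H c fun_eq_iff)
  have A_opt: "A_opt = R.recover"
    by (simp add: A_opt_def R.recover_def synth_def c d fun_eq_iff)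
  show ?thesis
    unfolding obs S M A_opt using R.compat_kernel R.recovery_optimal by blast
qed

end
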